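(* Let $k\ge1$ and $L\in GL_k(\mathbb{F}_3)$, and suppose that $$\operatorname{supp}(L^{\mathsf T}s)\ne\operatorname{supp}(s)\qquad\text{for every } s\in\mathbb{F}_3^k\setminus\{0\}.$$ Let $A_1,\dots,A_k\in\mathbb{Z}^{3\times3}$ be orthogonality factors with constants $\gamma_1,\dots,\gamma_k$ and put $\gamma=\prod_{i=1}^k\gamma_i\ne0$. Then $M=M_L(A_1,\dots,A_k)$ satisfies $$\sum_{v\in\mathbb{F}_3^k} M_{v,v}^{2}=\gamma\qquad\text{and}\qquad\sum_{v\in\mathbb{F}_3^k} M_{v,\bar v}^{2}=\gamma,$$ where $\bar v=(2,\dots,2)-v$. Consequently $M$ is an Euler magic matrix of order $3^k$ with constant $\gamma$.
   Context: For $s\in\mathbb{F}_3^k$, $\operatorname{supp}(s)=\{i : s_i\ne0\}$. An orthogonality factor with constant $\gamma$ is a matrix $A\in\mathbb{Z}^{n\times n}$ with $AA^{\mathsf T}=\gamma I$ and $\gamma\ne0$. A matrix $M\in\mathbb{Z}^{n\times n}$ (indices $0,\dots,n-1$) is an Euler magic matrix of order $n$ with constant $\gamma\in\mathbb{Z}$, $\gamma\ne0$, if $MM^{\mathsf T}=\gamma I$, $\sum_{i=0}^{n-1}M_{i,i}^2=\gamma$ and $\sum_{i=0}^{n-1}M_{i,n-1-i}^2=\gamma$. The set $\{0,1,\dots,3^k-1\}$ is identified with $\mathbb{F}_3^k$ by base-three digits, most significant first: $v=(v_1,\dots,v_k)$ corresponds to $\sum_{i=1}^k v_i3^{k-i}$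 (with $v_i\in\{0,1,2\}$). Rows and columns of $3\times 3$ matrices are indexed by $\mathbb{F}_3=\{0,1,2\}$. Under this identification $\bar v=(2,\dots,2)-v$ corresponds to $3^k-1-v$. For $L\in GL_k(\mathbb{F}_3)$ and $A_1,\dots,A_k\in\mathbb{Z}^{3\times3}$, the $L$-reindexed tensor product $M_L(A_1,\dots,A_k)\in\mathbb{Z}^{3^k\times3^k}$ has entries $M_L(A_1,\dots,A_k)_{v,w}=\prod_{i=1}^k(A_i)_{(Lv)_i,\,w_i}$ for $v,w\in\mathbb{F}_3^k$. *)

theory Defs
  imports "Jordan_Normal_Form.Matrix" "HOL-Library.Numeral_Type"
begin

text \<open>
  The field \<open>\<bbbF>\<^sub>3\<close> is the numeral type \<^typ>\<open>3\<close> (integers modulo 3), and \<open>\<bbbF>\<^sub>3\<^sup>k\<close> is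
  \<open>carrier_vec k :: 3 vec set\<close>. Coordinates of vectors are numbered from 0 to \<open>k - 1\<close>.
\<close>

definition digit :: "3 \<Rightarrow> nat"
  where "digit x = nat (Rep_bit1 x)"

definition supp :: "'a::zero vec \<Rightarrow> nat set"
  where "supp s = {i. i < dim_vec s \<and> s $ i \<noteq> 0}"

text \<open>
  The identification of \<open>\<bbbF>\<^sub>3\<^sup>k\<close> with \<open>{0..<3 ^ k}\<close>, most significant digit first. As coordinates
  start at 0, coordinate \<open>i\<close> has weight \<open>3 ^ (k - 1 - i)\<close>. The function \<open>vec_of_index\<close> is its
  inverse (the reduction modulo 3 happens in \<open>of_nat :: nat \<Rightarrow> 3\<close>); see
  \<open>index_of_vec_inverse\<close> and \<open>vec_of_index_inverse\<close> below.
\<close>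

definition index_of_vec :: "3 vec \<Rightarrow> nat"
  where "index_of_vec v = (\<Sum>i<dim_vec v. digit (v $ i) * 3 ^ (dim_vec v - 1 - i))"

definition vec_of_index :: "nat \<Rightarrow> nat \<Rightarrow> 3 vec"
  where "vec_of_index k n = vec k (\<lambda>i. of_nat (n div 3 ^ (k - 1 - i)))"

definition vec_bar :: "3 vec \<Rightarrow> 3 vec"
  where "vec_bar v = vec (dim_vec v) (\<lambda>i. 2) - v"

definition orthogonality_factor :: "nat \<Rightarrow> int \<Rightarrow> int mat \<Rightarrow> bool"
  where "orthogonality_factor n \<gamma> A \<longleftrightarrow>
    A \<in> carrier_mat n n \<and> A * transpose_mat A = \<gamma> \<cdot>\<^sub>m 1\<^sub>m n \<and> \<gamma> \<noteq> 0"

definition euler_magic :: "nat \<Rightarrow> int \<Rightarrow> int mat \<Rightarrow> bool"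
  where "euler_magic n \<gamma> M \<longleftrightarrow>
    M \<in> carrier_mat n n \<and> \<gamma> \<noteq> 0 \<and>
    M * transpose_mat M = \<gamma> \<cdot>\<^sub>m 1\<^sub>m n \<and>
    (\<Sum>i<n. (M $$ (i, i))\<^sup>2) = \<gamma> \<and>
    (\<Sum>i<n. (M $$ (i, n - 1 - i))\<^sup>2) = \<gamma>"

definition reindexed_tensor :: "nat \<Rightarrow> 3 mat \<Rightarrow> (nat \<Rightarrow> int mat) \<Rightarrow> int mat"
  where "reindexed_tensor k L A = mat (3 ^ k) (3 ^ k) (\<lambda>(r, c).
    let v = vec_of_index k r; w = vec_of_index k c
    in \<Prod>i<k. A i $$ (digit ((L *\<^sub>v v) $ i), digit (w $ i)))"


lemma digit_less: "digit x < 3"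
  using bit1.Rep_less_n[where 'a = num1, of x] by (simp add: digit_def)

lemma of_nat_digit: "of_nat (digit x) = x"
proof -
  have "0 \<le> Rep_bit1 x" using bit1.Rep_bit1[of x] by auto
  then show ?thesis
    using bit1.Rep_mod[where 'a = num1, of x]
    by (simp add: digit_def bit1.of_nat_eq bit1.Rep_bit1_inverse)
qed

lemma digit_of_nat: "digit (of_nat n) = n mod 3"
proof -
  have "Rep_bit1 (of_nat n :: 3) = int n mod 3"
    using bit1.Rep_Abs_mod[where 'a = num1, of "int n"] by (simp add: bit1.of_nat_eq)
  then show ?thesis by (simp add: digit_def nat_mod_distrib)
qed

lemma digit_complement: "digit (2 - x) = 2 - digit x"
proof -
  have "(2 :: 3) - x = of_nat (2 - digit x)"
    using digit_less[of x] by (simp add: of_nat_diff of_nat_digit)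
  then show ?thesis by (simp add: digit_of_nat)
qed

lemma index_of_vec_rev:
  "index_of_vec v = (\<Sum>i<dim_vec v. digit (v $ (dim_vec v - Suc i)) * 3 ^ i)"
proof -
  have "(\<Sum>i<dim_vec v. digit (v $ (dim_vec v - Suc i)) * 3 ^ i)
      = (\<Sum>i<dim_vec v. digit (v $ (dim_vec v - Suc (dim_vec v - Suc i))) * 3 ^ (dim_vec v - Suc i))"
    by (rule sum.nat_diff_reindex[symmetric])
  then show ?thesis by (auto simp: index_of_vec_def intro!: sum.cong)
qed

lemma ternary_less:
  fixes d :: "nat \<Rightarrow> nat"
  assumes "\<And>i. d i < 3"
  shows "(\<Sum>i<k. d i * 3 ^ i) < 3 ^ k"
proof (induction k)
  case (Suc k)
  have "d k * 3 ^ k \<le> 2 * 3 ^ k" using assms[of k] by (intro mult_right_mono) auto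
  with Suc have "(\<Sum>i<k. d i * 3 ^ i) + d k * 3 ^ k < 3 ^ k + 2 * 3 ^ k"
    by (rule add_less_le_mono)
  then show ?case by (simp only: sum.lessThan_Suc power_Suc)
qed simp

lemma ternary_digit:
  fixes d :: "nat \<Rightarrow> nat"
  assumes d: "\<And>i. d i < 3" and "j < k"
  shows "(\<Sum>i<k. d i * 3 ^ i) div 3 ^ j mod 3 = d j"
  using \<open>j < k\<close>
proof (induction k)
  case (Suc k)
  show ?case
  proof (cases "j = k")
    case True
    then show ?thesis using ternary_less[of d k] d[of k] by (simp add: d)
  next
    case False
    with Suc.prems have "j < k" by simp
    then obtain e where e: "k = j + Suc e" using less_iff_Suc_add by auto
    have "(\<Sum>i<Suc k. d i * 3 ^ i) div 3 ^ j
        = ((\<Sum>i<k. d i * 3 ^ i) + 3 ^ j * (3 * (d k * 3 ^ e))) div 3 ^ j"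
      by (simp add: e power_add mult_ac)
    also have "\<dots> = 3 * (d k * 3 ^ e) + (\<Sum>i<k. d i * 3 ^ i) div 3 ^ j"
      by (subst div_mult_self2) auto
    finally show ?thesis using Suc.IH[OF \<open>j < k\<close>] by (simp only: mod_mult_self4)
  qed
qed simp

lemma ternary_expansion: "(\<Sum>i<k. (n div 3 ^ i mod 3) * 3 ^ i) = (n mod 3 ^ k :: nat)"
proof (induction k)
  case (Suc k)
  have "n mod 3 ^ Suc k = n mod (3 ^ k * 3)" by (simp add: mult.commute)
  also have "\<dots> = 3 ^ k * (n div 3 ^ k mod 3) + n mod 3 ^ k" by (rule mod_mult2_eq)
  finally show ?case using Suc by (simp add: mult.commute)
qed simp

lemma vec_of_index_carrier: "vec_of_index k n \<in> carrier_vec k"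
  by (simp add: vec_of_index_def)

lemma index_of_vec_less: "v \<in> carrier_vec k \<Longrightarrow> index_of_vec v < 3 ^ k"
  by (auto simp: index_of_vec_rev digit_less intro!: ternary_less)

lemma index_of_vec_inverse:
  assumes "v \<in> carrier_vec k"
  shows "vec_of_index k (index_of_vec v) = v"
proof (rule eq_vecI)
  fix i assume "i < dim_vec v"
  then have i: "i < k" using assms by simp
  let ?n = "index_of_vec v div 3 ^ (k - 1 - i)"
  have "?n mod 3 = digit (v $ (k - Suc (k - 1 - i)))"
    using assms i ternary_digit[of "\<lambda>i. digit (v $ (k - Suc i))" "k - 1 - i" k]
    by (simp add: index_of_vec_rev digit_less)
  then have "digit (of_nat ?n) = digit (v $ i)" using i by (simp add: digit_of_nat)
  then have "of_nat ?n = v $ i" by (metis of_nat_digit)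
  then show "vec_of_index k (index_of_vec v) $ i = v $ i" using i by (simp add: vec_of_index_def)
qed (use assms in \<open>simp add: vec_of_index_def\<close>)

lemma vec_of_index_inverse:
  assumes "n < 3 ^ k"
  shows "index_of_vec (vec_of_index k n) = n"
proof -
  have "index_of_vec (vec_of_index k n) = (\<Sum>i<k. (n div 3 ^ i mod 3) * 3 ^ i)"
    by (auto simp: index_of_vec_rev vec_of_index_def digit_of_nat intro!: sum.cong)
  then show ?thesis using assms by (simp add: ternary_expansion)
qed

lemma bij_betw_index_of_vec: "bij_betw index_of_vec (carrier_vec k) {..<3 ^ k}"
  by (rule bij_betw_byWitness[where f' = "vec_of_index k"])
    (auto simp: index_of_vec_inverse vec_of_index_inverse index_of_vec_less vec_of_index_carrier)

lemma index_of_vec_bar: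
  assumes "v \<in> carrier_vec k"
  shows "index_of_vec (vec_bar v) = 3 ^ k - 1 - index_of_vec v"
proof -
  have dim: "dim_vec v = k" using assms by simp
  have "index_of_vec (vec_bar v) + index_of_vec v
      = (\<Sum>i<k. (2 - digit (v $ i)) * 3 ^ (k - 1 - i) + digit (v $ i) * 3 ^ (k - 1 - i))"
    by (simp add: index_of_vec_def vec_bar_def dim digit_complement sum.distrib)
  also have "\<dots> = (\<Sum>i<k. 2 * 3 ^ (k - Suc i))"
  proof (rule sum.cong)
    fix i
    have "2 - digit (v $ i) + digit (v $ i) = 2" using digit_less[of "v $ i"] by simp
    then show "(2 - digit (v $ i)) * 3 ^ (k - 1 - i) + digit (v $ i) * 3 ^ (k - 1 - i)
        = 2 * 3 ^ (k - Suc i)"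
      by (simp flip: add_mult_distrib)
  qed simp
  also have "\<dots> = (\<Sum>i<k. 2 * 3 ^ i)" by (rule sum.nat_diff_reindex)
  also have "\<dots> = 3 ^ k - 1"
  proof (induction k)
    case (Suc k)
    have "(1::nat) \<le> 3 ^ k" by simp
    with Suc show ?case by simp
  qed simp
  finally show ?thesis by simp
qed

lemma reindexed_tensor_entry:
  assumes "v \<in> carrier_vec k" "w \<in> carrier_vec k"
  shows "reindexed_tensor k L A $$ (index_of_vec v, index_of_vec w)
    = (\<Prod>i<k. A i $$ (digit ((L *\<^sub>v v) $ i), digit (w $ i)))"
  using assms by (simp add: reindexed_tensor_def index_of_vec_less index_of_vec_inverse)

end

theory Submission
  imports Defs Complex_Main "Jordan_Normal_Form.Determinant"
begin

text \<open>
  The Fourier expansion of \<open>f\<^sub>i(a, b) = (A\<^sub>i)\<^sub>a\<^sub>b\<^sup>2\<close> over \<open>\<bbbF>\<^sub>3\<^sup>2\<close> has \<open>c\<^sub>i(s, t) = 0\<close> whenever exactly one of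
  \<open>s, t\<close> vanishes, because all row and column sums of \<open>f\<^sub>i\<close> are equal to \<open>\<gamma>\<^sub>i\<close>. Expanding the product
  and summing over \<open>v\<close>, a pair \<open>(s, t)\<close> of vectors of frequencies contributes only if
  \<open>L\<^sup>T s + t = 0\<close> and \<open>supp s = supp t\<close>. The hypothesis on \<open>L\<close> then forces \<open>s = t = 0\<close>, and this term
  is \<open>\<Prod>\<^sub>i \<gamma>\<^sub>i\<close>. The antidiagonal reduces to the diagonal by replacing \<open>f\<^sub>i(a, b)\<close> by \<open>f\<^sub>i(a, 2 - b)\<close>.
\<close>

section \<open>An additive character of the field with three elements\<close>

text \<open>The primitive cube root of unity \<open>exp (2 * pi * \<i> / 3)\<close>.\<close>

definition root3 :: complex
  where "root3 = Complex (- 1 / 2) (sqrt 3 / 2)"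

definition chi :: "3 \<Rightarrow> complex"
  where "chi x = root3 ^ digit x"

lemma root3_square: "root3\<^sup>2 = Complex (- 1 / 2) (- sqrt 3 / 2)"
  by (simp add: root3_def power2_eq_square complex_eq_iff)

lemma root3_cube: "root3 ^ 3 = 1"
proof -
  have "root3 ^ 3 = root3\<^sup>2 * root3" by (simp add: numeral_eq_Suc)
  then show ?thesis by (simp add: root3_square) (simp add: root3_def complex_eq_iff)
qed

lemma root3_power_mod: "root3 ^ (n mod 3) = root3 ^ n"
proof -
  have "root3 ^ n = root3 ^ (3 * (n div 3) + n mod 3)" by simp
  also have "\<dots> = root3 ^ (n mod 3)"
    by (simp only: power_add power_mult root3_cube power_one mult_1)
  finally show ?thesis by simp
qed

lemma digit_zero [simp]: "digit 0 = 0"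
  using digit_of_nat[of 0] by simp

lemma inj_digit: "inj digit"
  by (metis injI of_nat_digit)

lemma bij_betw_digit: "bij_betw digit UNIV {..<3}"
  by (rule bij_betw_byWitness[where f' = of_nat]) (auto simp: of_nat_digit digit_of_nat digit_less)

lemma sum_digit: "(\<Sum>x\<in>UNIV. f (digit x)) = (\<Sum>i<3. f i)"
  by (rule sum.reindex_bij_betw[OF bij_betw_digit])

lemma chi_zero [simp]: "chi 0 = 1"
  by (simp add: chi_def)

lemma chi_add: "chi (a + b) = chi a * chi b"
proof -
  have "digit (a + b) = (digit a + digit b) mod 3"
    by (metis digit_of_nat of_nat_add of_nat_digit)
  then show ?thesis by (simp add: chi_def root3_power_mod power_add)
qed

lemma chi_sum: "chi (sum f S) = (\<Prod>i\<in>S. chi (f i))"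
  by (induction S rule: infinite_finite_induct) (auto simp: chi_add)

lemma chi_eq_1_iff: "chi x = 1 \<longleftrightarrow> x = 0"
proof
  assume x: "chi x = 1"
  have "digit x = 0 \<or> digit x = 1 \<or> digit x = 2" using digit_less[of x] by linarith
  moreover have "root3 \<noteq> 1" "root3\<^sup>2 \<noteq> 1"
    unfolding root3_square by (simp_all add: root3_def complex_eq_iff)
  ultimately have "digit x = digit 0" using x by (auto simp: chi_def)
  then show "x = 0" using inj_digit by (blast dest: injD)
qed simp

text \<open>Orthogonality of characters: translating \<open>s\<close> by 1 multiplies the sum by
  \<open>chi d\<close>, which differs from 1 for \<open>d \<noteq> 0\<close>, so the sum must
  vanish.\<close>

lemma sum_chi_mult: "(\<Sum>s\<in>UNIV. chi (s * d)) = (if d = 0 then 3 else 0)"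
proof (cases "d = 0")
  case False
  have "(\<Sum>s\<in>UNIV. chi (s * d)) = (\<Sum>s\<in>UNIV. chi ((s + 1) * d))"
    by (rule sum.reindex_bij_witness[where i = "\<lambda>s. s + 1" and j = "\<lambda>s. s - 1"]) auto
  also have "\<dots> = chi d * (\<Sum>s\<in>UNIV. chi (s * d))"
    by (simp add: algebra_simps chi_add sum_distrib_left)
  finally show ?thesis using False by (simp add: chi_eq_1_iff)
qed simp

section \<open>Sums over vectors\<close>

lemma finite_carrier_vec3: "finite (carrier_vec k :: 3 vec set)"
  using bij_betw_finite[OF bij_betw_index_of_vec[of k]] by simp

lemma card_carrier_vec3: "card (carrier_vec k :: 3 vec set) = 3 ^ k"
  using bij_betw_same_card[OF bij_betw_index_of_vec[of k]] by simp

text \<open>The translation argument again, now along a unit vector at a coordinate where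
  \<open>x\<close> is nonzero.\<close>

lemma sum_chi_scalar_prod:
  assumes x: "x \<in> carrier_vec k" and "x \<noteq> 0\<^sub>v k"
  shows "(\<Sum>v\<in>carrier_vec k. chi (x \<bullet> v)) = 0"
proof -
  obtain i where i: "i < k" "x $ i \<noteq> 0"
    using assms by (metis carrier_vecD eq_vecI index_zero_vec)
  let ?e = "unit_vec k i :: 3 vec"
  have shift: "v - ?e + ?e = v" "v + ?e - ?e = v" if "v \<in> carrier_vec k" for v
    using that by (auto intro!: eq_vecI)
  have "(\<Sum>v\<in>carrier_vec k. chi (x \<bullet> v)) = (\<Sum>v\<in>carrier_vec k. chi (x \<bullet> (v + ?e)))"
    by (rule sum.reindex_bij_witness[where i = "\<lambda>v. v + ?e" and j = "\<lambda>v. v - ?e"])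
      (auto simp: shift)
  also have "\<dots> = chi (x $ i) * (\<Sum>v\<in>carrier_vec k. chi (x \<bullet> v))"
    unfolding sum_distrib_left using x i
    by (intro sum.cong) (auto simp: scalar_prod_add_distrib[where n = k] chi_add mult.commute)
  finally show ?thesis using i by (simp add: chi_eq_1_iff)
qed

lemma sum_carrier_vec_prod:
  fixes h :: "nat \<Rightarrow> 3 \<Rightarrow> 'a::comm_semiring_1"
  shows "(\<Sum>w\<in>carrier_vec k. \<Prod>i<k. h i (w $ i)) = (\<Prod>i<k. \<Sum>b\<in>UNIV. h i b)"
proof -
  have "(\<Prod>i<k. \<Sum>b\<in>UNIV. h i b) = (\<Sum>g\<in>{..<k} \<rightarrow>\<^sub>E UNIV. \<Prod>i<k. h i (g i))"
    by (rule prod_sum_PiE) auto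
  also have "\<dots> = (\<Sum>w\<in>carrier_vec k. \<Prod>i<k. h i (w $ i))"
    \<comment> \<open>The restriction supplies the value \<open>undefined\<close> outside
      \<open>{..<k}\<close> that membership in \<open>PiE\<close> demands.\<close>
    by (rule sum.reindex_bij_witness[where i = "\<lambda>w. restrict (($) w) {..<k}" and j = "vec k"])
      (auto intro!: eq_vecI simp: restrict_def PiE_def extensional_def)
  finally show ?thesis by simp
qed

section \<open>Fourier analysis of arrays with constant line sums\<close>

text \<open>The division by 9, the order of the group of pairs, makes the inversion formula free of
  constants.\<close>

definition fourier :: "(3 \<Rightarrow> 3 \<Rightarrow> complex) \<Rightarrow> 3 \<Rightarrow> 3 \<Rightarrow> complex"
  where "fourier f s t = (\<Sum>a\<in>UNIV. \<Sum>b\<in>UNIV. f a b * chi (- (s * a)) * chi (- (t * b))) / 9"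

text \<open>After the frequency sums are moved inside, they vanish unless \<open>a' = a\<close> and
  \<open>b' = b\<close>, where they give 3 * 3 and cancel the 9.\<close>

lemma fourier_inversion:
  "f a b = (\<Sum>(s, t)\<in>UNIV. fourier f s t * chi (s * a + t * b))"
proof -
  have chi_diff: "chi (s * (x - y)) = chi (s * x) * chi (- (s * y))" for s x y
    by (simp add: right_diff_distrib flip: chi_add)
  have "(\<Sum>(s, t)\<in>UNIV. fourier f s t * chi (s * a + t * b))
      = (\<Sum>s\<in>UNIV. \<Sum>t\<in>UNIV. \<Sum>a'\<in>UNIV. \<Sum>b'\<in>UNIV.
          f a' b' * (chi (s * (a - a')) * chi (t * (b - b'))) / 9)"
    unfolding UNIV_Times_UNIV[symmetric] sum.cartesian_product[symmetric]
    by (simp add: fourier_def chi_diff chi_add sum_divide_distrib sum_distrib_left mult_ac)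
  also have "\<dots> = (\<Sum>a'\<in>UNIV. \<Sum>b'\<in>UNIV. \<Sum>s\<in>UNIV. \<Sum>t\<in>UNIV.
          f a' b' * (chi (s * (a - a')) * chi (t * (b - b'))) / 9)"
    unfolding sum.cartesian_product
    by (rule sum.reindex_bij_witness[where i = "\<lambda>(a', b', s, t). (s, t, a', b')"
          and j = "\<lambda>(s, t, a', b'). (a', b', s, t)"]) auto
  also have "\<dots> = (\<Sum>a'\<in>UNIV. \<Sum>b'\<in>UNIV.
      f a' b' * ((\<Sum>s\<in>UNIV. chi (s * (a - a'))) * (\<Sum>t\<in>UNIV. chi (t * (b - b')))) / 9)"
    unfolding sum_product by (simp only: sum_distrib_left sum_divide_distrib)
  also have "\<dots> = (\<Sum>a'\<in>UNIV. \<Sum>b'\<in>UNIV. if a' = a then if b' = b then f a' b' else 0 else 0)"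
    by (intro sum.cong) (auto simp: sum_chi_mult)
  also have "\<dots> = f a b"
    \<comment> \<open>The outer condition concerns \<open>a'\<close>, so the sum over
      \<open>a'\<close> has to be the inner one to collapse.\<close>
    by (subst sum.swap) simp
  finally show ?thesis by simp
qed

text \<open>At \<open>t = 0\<close> the inner sum over \<open>b\<close> is the constant
  \<open>\<gamma>\<close>, which leaves a character sum over \<open>a\<close> at a nonzero
  frequency.\<close>

lemma fourier_row_zero:
  assumes "\<And>a. (\<Sum>b\<in>UNIV. f a b) = \<gamma>" and "s \<noteq> 0"
  shows "fourier f s 0 = 0"
  using assms sum_chi_mult[of "- s"]
  by (simp add: fourier_def mult.commute flip: sum_distrib_left sum_distrib_right)

lemma fourier_column_zero:
  assumes "\<And>b. (\<Sum>a\<in>UNIV. f a b) = \<gamma>" and "t \<noteq> 0"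
  shows "fourier f 0 t = 0"
  unfolding fourier_def using assms sum_chi_mult[of "- t"]
  by (subst sum.swap) (simp add: mult.commute flip: sum_distrib_left sum_distrib_right)

lemma fourier_zero_zero:
  assumes "\<And>a. (\<Sum>b\<in>UNIV. f a b) = \<gamma>"
  shows "fourier f 0 0 = \<gamma> / 3"
  by (simp add: fourier_def assms)

text \<open>The analytic core, stated for arbitrary arrays with constant line sums so that it serves
  the diagonal and the antidiagonal alike.\<close>

lemma sum_prod_constant_line_sums:
  fixes f :: "nat \<Rightarrow> 3 \<Rightarrow> 3 \<Rightarrow> complex"
  assumes L: "L \<in> carrier_mat k k"
    and supp: "\<And>s. s \<in> carrier_vec k - {0\<^sub>v k} \<Longrightarrow> supp (transpose_mat L *\<^sub>v s) \<noteq> supp s"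
    and row: "\<And>i a. i < k \<Longrightarrow> (\<Sum>b\<in>UNIV. f i a b) = \<gamma> i"
    and column: "\<And>i b. i < k \<Longrightarrow> (\<Sum>a\<in>UNIV. f i a b) = \<gamma> i"
  shows "(\<Sum>v\<in>carrier_vec k. \<Prod>i<k. f i ((L *\<^sub>v v) $ i) (v $ i)) = (\<Prod>i<k. \<gamma> i)"
proof -
  \<comment> \<open>An element \<open>g\<close> of \<open>?P\<close> picks a pair of frequencies for
    each coordinate; \<open>S g\<close> and \<open>T g\<close> collect the two components, and
    \<open>z\<close> picks only zeros.\<close>
  let ?P = "{..<k} \<rightarrow>\<^sub>E (UNIV :: (3 \<times> 3) set)"
  define z :: "nat \<Rightarrow> 3 \<times> 3" where "z = restrict (\<lambda>i. (0, 0)) {..<k}"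
  define S T :: "(nat \<Rightarrow> 3 \<times> 3) \<Rightarrow> 3 vec"
    where "S g = vec k (\<lambda>i. fst (g i))" and "T g = vec k (\<lambda>i. snd (g i))" for g
  define c where "c g = (\<Prod>i<k. fourier (f i) (fst (g i)) (snd (g i)))" for g
  \<comment> \<open>The total frequency of the term \<open>g\<close> as a character of
    \<open>v\<close>: moving \<open>L\<close> to the other side of the scalar product turns
    \<open>S g\<close> into its image under the transpose.\<close>
  define x where "x g = transpose_mat L *\<^sub>v S g + T g" for g
  have carr: "S g \<in> carrier_vec k" "T g \<in> carrier_vec k" "transpose_mat L *\<^sub>v S g \<in> carrier_vec k"
    "x g \<in> carrier_vec k" for g
    using L by (auto simp: S_def T_def x_def)
  have supp_S: "supp (S g) = {i. i < k \<and> fst (g i) \<noteq> 0}"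
    and supp_T: "supp (T g) = {i. i < k \<and> snd (g i) \<noteq> 0}" for g
    by (auto simp: supp_def S_def T_def)
  have expand: "(\<Prod>i<k. f i ((L *\<^sub>v v) $ i) (v $ i)) = (\<Sum>g\<in>?P. c g * chi (x g \<bullet> v))"
    if v: "v \<in> carrier_vec k" for v
  proof -
    have Lv: "L *\<^sub>v v \<in> carrier_vec k" using L v by simp
    have scalar_prod_lessThan: "y \<bullet> u = (\<Sum>i<k. y $ i * u $ i)"
      if "u \<in> carrier_vec k" for y u :: "3 vec"
      using that by (simp add: scalar_prod_def atLeast0LessThan)
    have "(\<Prod>i<k. f i ((L *\<^sub>v v) $ i) (v $ i)) = (\<Prod>i<k. \<Sum>p\<in>UNIV.
        fourier (f i) (fst p) (snd p) * chi (fst p * (L *\<^sub>v v) $ i + snd p * v $ i))"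
      by (simp add: fourier_inversion[of "f i" for i] split_def)
    also have "\<dots> = (\<Sum>g\<in>?P. \<Prod>i<k. fourier (f i) (fst (g i)) (snd (g i)) *
        chi (fst (g i) * (L *\<^sub>v v) $ i + snd (g i) * v $ i))"
      by (rule prod_sum_PiE) auto
    also have "\<dots> = (\<Sum>g\<in>?P. c g * chi (x g \<bullet> v))"
    proof (rule sum.cong[OF refl])
      fix g
      have "x g \<bullet> v = (transpose_mat L *\<^sub>v S g) \<bullet> v + T g \<bullet> v"
        unfolding x_def using carr v by (intro add_scalar_prod_distrib) auto
      also have "(transpose_mat L *\<^sub>v S g) \<bullet> v = S g \<bullet> (L *\<^sub>v v)"
        using L carr v by (metis transpose_vec_mult_scalar comm_scalar_prod mult_mat_vec_carrier)
      also have "S g \<bullet> (L *\<^sub>v v) + T g \<bullet> v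
          = (\<Sum>i<k. fst (g i) * (L *\<^sub>v v) $ i + snd (g i) * v $ i)"
        using Lv v by (simp add: scalar_prod_lessThan S_def T_def sum.distrib del: index_mult_mat_vec)
      finally show "(\<Prod>i<k. fourier (f i) (fst (g i)) (snd (g i)) *
          chi (fst (g i) * (L *\<^sub>v v) $ i + snd (g i) * v $ i)) = c g * chi (x g \<bullet> v)"
        by (simp add: c_def prod.distrib chi_sum)
    qed
    finally show ?thesis .
  qed
  have vanish: "c g * (\<Sum>v\<in>carrier_vec k. chi (x g \<bullet> v)) = 0" if g: "g \<in> ?P" "g \<noteq> z" for g
  proof (cases "supp (S g) = supp (T g)")
    case False
    \<comment> \<open>At a coordinate in only one of the supports, exactly one frequency is zero, so
      that Fourier coefficient kills \<open>c g\<close>.\<close>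
    then obtain i where i: "i < k"
      "fst (g i) = 0 \<and> snd (g i) \<noteq> 0 \<or> fst (g i) \<noteq> 0 \<and> snd (g i) = 0"
      unfolding supp_S supp_T by blast
    then have "fourier (f i) (fst (g i)) (snd (g i)) = 0"
      using fourier_row_zero[of "f i", OF row[OF i(1)]]
        fourier_column_zero[of "f i", OF column[OF i(1)]] by auto
    then show ?thesis using i by (auto simp: c_def)
  next
    case True
    \<comment> \<open>With equal supports, \<open>S g = 0\<close> would force \<open>T g = 0\<close>
      and hence \<open>g = z\<close>.\<close>
    have "S g \<noteq> 0\<^sub>v k"
    proof
      assume S0: "S g = 0\<^sub>v k"
      have "g i = (0, 0)" if "i < k" for i
      proof -
        have "i \<notin> supp (S g)" using S0 by (simp add: supp_def)
        moreover from this have "i \<notin> supp (T g)" unfolding True .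
        ultimately show ?thesis using that by (simp add: supp_S supp_T prod_eq_iff)
      qed
      then have "g = z" using g(1) by (intro ext) (auto simp: z_def PiE_def extensional_def)
      with g show False by simp
    qed
    then have ne: "supp (transpose_mat L *\<^sub>v S g) \<noteq> supp (T g)"
      using supp[of "S g"] carr True by auto
    \<comment> \<open>Otherwise \<open>T g\<close> would be the negative of the transformed
      \<open>S g\<close>, and negation preserves supports.\<close>
    have "x g \<noteq> 0\<^sub>v k"
    proof
      assume x0: "x g = 0\<^sub>v k"
      have "(transpose_mat L *\<^sub>v S g) $ i + T g $ i = 0" if "i < k" for i
        using x0 that carr(2)[of g] by (metis x_def carrier_vecD index_add_vec(1) index_zero_vec(1))
      then have "(transpose_mat L *\<^sub>v S g) $ i = 0 \<longleftrightarrow> T g $ i = 0" if "i < k" for i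
        using that by (metis add.left_neutral add.right_neutral)
      then show False
        using ne carr(2,3)[of g] unfolding supp_def by (metis (no_types, lifting) carrier_vecD)
    qed
    then show ?thesis using sum_chi_scalar_prod[OF carr(4)[of g]] by simp
  qed
  have fin: "finite ?P" by (intro finite_PiE) auto
  have "(\<Sum>v\<in>carrier_vec k. \<Prod>i<k. f i ((L *\<^sub>v v) $ i) (v $ i))
      = (\<Sum>v\<in>carrier_vec k. \<Sum>g\<in>?P. c g * chi (x g \<bullet> v))"
    using expand by (intro sum.cong) auto
  also have "\<dots> = (\<Sum>g\<in>?P. c g * (\<Sum>v\<in>carrier_vec k. chi (x g \<bullet> v)))"
    unfolding sum_distrib_left by (rule sum.swap)
  also have "\<dots> = (\<Sum>g\<in>{z}. c g * (\<Sum>v\<in>carrier_vec k. chi (x g \<bullet> v)))"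
    using fin vanish by (intro sum.mono_neutral_right) (auto simp: z_def)
  \<comment> \<open>The trivial character sums to the number of vectors; this cancels the factor 1/3
    in each of the \<open>k\<close> coefficients of \<open>c z\<close>.\<close>
  also have "\<dots> = c z * 3 ^ k"
  proof -
    have "S z = 0\<^sub>v k" "T z = 0\<^sub>v k" by (auto simp: S_def T_def z_def intro!: eq_vecI)
    then have "x z = 0\<^sub>v k" using L by (auto simp: x_def)
    then show ?thesis by (simp add: card_carrier_vec3)
  qed
  also have "c z = (\<Prod>i<k. \<gamma> i / 3)"
    unfolding c_def z_def by (intro prod.cong) (auto simp: fourier_zero_zero row)
  also have "\<dots> * 3 ^ k = (\<Prod>i<k. \<gamma> i)"
    by (simp add: prod_dividef)
  finally show ?thesis .
qed

section \<open>Orthogonality factors\<close>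

text \<open>Over the rationals the transpose divided by \<open>\<gamma>\<close> is a right inverse
  of the square matrix \<open>A\<close>, hence also a left inverse. Scaling back and injectivity of
  the embedding return the identity to the integers.\<close>

lemma orthogonality_factor_transpose:
  assumes "orthogonality_factor n \<gamma> A"
  shows "transpose_mat A * A = \<gamma> \<cdot>\<^sub>m 1\<^sub>m n"
proof -
  let ?r = "map_mat rat_of_int"
  from assms have A: "A \<in> carrier_mat n n" "A * transpose_mat A = \<gamma> \<cdot>\<^sub>m 1\<^sub>m n" "\<gamma> \<noteq> 0"
    by (auto simp: orthogonality_factor_def)
  define C where "C = (1 / rat_of_int \<gamma>) \<cdot>\<^sub>m ?r (transpose_mat A)"
  have [simp]: "?r A \<in> carrier_mat n n" "?r (transpose_mat A) \<in> carrier_mat n n"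
    using A by auto
  have "?r A * C = (1 / rat_of_int \<gamma>) \<cdot>\<^sub>m ?r (A * transpose_mat A)"
    using A(1)
    by (simp add: C_def of_int_hom.mat_hom_mult[of _ n n _ n] mult_smult_distrib[of _ n n _ n])
  also have "\<dots> = 1\<^sub>m n" unfolding A(2) using A(3) by (auto intro!: eq_matI)
  finally have "C * ?r A = 1\<^sub>m n"
    by (rule mat_mult_left_right_inverse[rotated 2]) (auto simp: C_def A)
  then have "(1 / rat_of_int \<gamma>) \<cdot>\<^sub>m ?r (transpose_mat A * A) = 1\<^sub>m n"
    using A(1)
    by (simp add: C_def of_int_hom.mat_hom_mult[of _ n n _ n] mult_smult_assoc_mat[of _ n n _ n])
  then have "rat_of_int \<gamma> \<cdot>\<^sub>m ((1 / rat_of_int \<gamma>) \<cdot>\<^sub>m ?r (transpose_mat A * A))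
      = rat_of_int \<gamma> \<cdot>\<^sub>m 1\<^sub>m n"
    by simp
  also have "rat_of_int \<gamma> \<cdot>\<^sub>m ((1 / rat_of_int \<gamma>) \<cdot>\<^sub>m ?r (transpose_mat A * A))
      = ?r (transpose_mat A * A)"
    using A(3) by (auto intro!: eq_matI)
  also have "rat_of_int \<gamma> \<cdot>\<^sub>m 1\<^sub>m n = ?r (\<gamma> \<cdot>\<^sub>m 1\<^sub>m n)"
    by (auto intro!: eq_matI)
  finally show ?thesis by (rule of_int_hom.mat_hom_inj)
qed

lemma orthogonality_factor_row_product:
  assumes "orthogonality_factor n \<gamma> A" "a < n" "b < n"
  shows "(\<Sum>j<n. A $$ (a, j) * A $$ (b, j)) = (if a = b then \<gamma> else 0)"
proof -
  from assms have A: "A \<in> carrier_mat n n" "A * transpose_mat A = \<gamma> \<cdot>\<^sub>m 1\<^sub>m n"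
    by (auto simp: orthogonality_factor_def)
  have "(A * transpose_mat A) $$ (a, b) = (\<Sum>j<n. A $$ (a, j) * A $$ (b, j))"
    using A(1) assms by (simp add: scalar_prod_def atLeast0LessThan)
  then show ?thesis using assms unfolding A(2) by (cases "a = b") auto
qed

lemma orthogonality_factor_column_square_sum:
  assumes "orthogonality_factor n \<gamma> A" "b < n"
  shows "(\<Sum>i<n. (A $$ (i, b))\<^sup>2) = \<gamma>"
proof -
  from assms have A: "A \<in> carrier_mat n n"
    by (auto simp: orthogonality_factor_def)
  have "(transpose_mat A * A) $$ (b, b) = (\<Sum>i<n. (A $$ (i, b))\<^sup>2)"
    using A assms by (simp add: scalar_prod_def atLeast0LessThan power2_eq_square)
  then show ?thesis using orthogonality_factor_transpose[OF assms(1)] assms by simp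
qed

section \<open>The reindexed tensor product\<close>

lemma invertible_mult_vec_inj:
  fixes L :: "'a::comm_ring_1 mat"
  assumes "L \<in> carrier_mat k k" "invertible_mat L"
    and "v \<in> carrier_vec k" "w \<in> carrier_vec k" "L *\<^sub>v v = L *\<^sub>v w"
  shows "v = w"
proof -
  from assms obtain B where B: "L * B = 1\<^sub>m k" "B * L = 1\<^sub>m (dim_row B)"
    by (auto simp: invertible_mat_def inverts_mat_def)
  \<comment> \<open>\<open>invertible_mat\<close> leaves the dimensions of the inverse implicit;
    both products reveal them.\<close>
  have "dim_col B = k" using arg_cong[OF B(1), of dim_col] by simp
  moreover have "dim_row B = k" using arg_cong[OF B(2), of dim_col] assms(1) by simp
  ultimately have "B \<in> carrier_mat k k" "B * L = 1\<^sub>m k" using B by auto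
  then have "u = B *\<^sub>v (L *\<^sub>v u)" if "u \<in> carrier_vec k" for u
    using that assms(1) by (simp flip: assoc_mult_mat_vec)
  then show ?thesis using assms by metis
qed

lemma sum_index_of_vec: "(\<Sum>v\<in>carrier_vec k. f (index_of_vec v)) = (\<Sum>i<3 ^ k. f i)"
  by (rule sum.reindex_bij_betw[OF bij_betw_index_of_vec])

text \<open>The inner product of rows \<open>v\<close> and \<open>v'\<close> factors over the
  coordinates into inner products of rows of the \<open>A i\<close>. Some factor vanishes unless
  \<open>L\<close> maps both vectors to the same image, which by invertibility means
  \<open>v = v'\<close>.\<close>

lemma reindexed_tensor_orthogonal:
  assumes L: "L \<in> carrier_mat k k" "invertible_mat L"
    and A: "\<And>i. i < k \<Longrightarrow> orthogonality_factor 3 (\<gamma> i) (A i)"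
  shows "reindexed_tensor k L A * transpose_mat (reindexed_tensor k L A)
    = (\<Prod>i<k. \<gamma> i) \<cdot>\<^sub>m 1\<^sub>m (3 ^ k)"
proof (rule eq_matI)
  let ?M = "reindexed_tensor k L A"
  have M: "?M \<in> carrier_mat (3 ^ k) (3 ^ k)" by (simp add: reindexed_tensor_def)
  fix r r' assume "r < dim_row ((\<Prod>i<k. \<gamma> i) \<cdot>\<^sub>m 1\<^sub>m (3 ^ k))"
    "r' < dim_col ((\<Prod>i<k. \<gamma> i) \<cdot>\<^sub>m 1\<^sub>m (3 ^ k))"
  then have r: "r < 3 ^ k" "r' < 3 ^ k" by auto
  define v v' where "v = vec_of_index k r" and "v' = vec_of_index k r'"
  have v: "v \<in> carrier_vec k" "v' \<in> carrier_vec k" "index_of_vec v = r" "index_of_vec v' = r'"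
    using r by (auto simp: v_def v'_def vec_of_index_carrier vec_of_index_inverse)
  have "(?M * transpose_mat ?M) $$ (r, r') = (\<Sum>j<3 ^ k. ?M $$ (r, j) * ?M $$ (r', j))"
    using M r by (simp add: scalar_prod_def atLeast0LessThan)
  also have "\<dots> = (\<Sum>w\<in>carrier_vec k. ?M $$ (r, index_of_vec w) * ?M $$ (r', index_of_vec w))"
    by (rule sum_index_of_vec[symmetric])
  also have "\<dots> = (\<Sum>w\<in>carrier_vec k. \<Prod>i<k. A i $$ (digit ((L *\<^sub>v v) $ i), digit (w $ i)) *
      A i $$ (digit ((L *\<^sub>v v') $ i), digit (w $ i)))"
    using v by (intro sum.cong) (auto simp: reindexed_tensor_entry prod.distrib simp flip: v(3,4))
  also have "\<dots> = (\<Prod>i<k. \<Sum>b\<in>UNIV. A i $$ (digit ((L *\<^sub>v v) $ i), digit b) *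
      A i $$ (digit ((L *\<^sub>v v') $ i), digit b))"
    by (rule sum_carrier_vec_prod)
  also have "\<dots> = (\<Prod>i<k. if (L *\<^sub>v v) $ i = (L *\<^sub>v v') $ i then \<gamma> i else 0)"
  proof (rule prod.cong[OF refl])
    fix i assume "i \<in> {..<k}"
    then have "i < k" by simp
    show "(\<Sum>b\<in>UNIV. A i $$ (digit ((L *\<^sub>v v) $ i), digit b) *
        A i $$ (digit ((L *\<^sub>v v') $ i), digit b))
      = (if (L *\<^sub>v v) $ i = (L *\<^sub>v v') $ i then \<gamma> i else 0)"
      using orthogonality_factor_row_product[OF A[OF \<open>i < k\<close>] digit_less digit_less]
      by (subst sum_digit) (simp add: inj_eq[OF inj_digit])
  qed
  also have "\<dots> = (if r = r' then \<Prod>i<k. \<gamma> i else 0)"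
  proof (cases "r = r'")
    case True
    then show ?thesis by (simp add: v_def v'_def)
  next
    case False
    then have "L *\<^sub>v v \<noteq> L *\<^sub>v v'" using invertible_mult_vec_inj[OF L v(1,2)] v by auto
    moreover have "L *\<^sub>v v \<in> carrier_vec k" "L *\<^sub>v v' \<in> carrier_vec k" using L v by auto
    ultimately obtain i where "i < k" "(L *\<^sub>v v) $ i \<noteq> (L *\<^sub>v v') $ i"
      by (metis carrier_vecD eq_vecI)
    then show ?thesis using False by auto
  qed
  also have "\<dots> = ((\<Prod>i<k. \<gamma> i) \<cdot>\<^sub>m 1\<^sub>m (3 ^ k)) $$ (r, r')"
    using r by simp
  finally show "(?M * transpose_mat ?M) $$ (r, r') = ((\<Prod>i<k. \<gamma> i) \<cdot>\<^sub>m 1\<^sub>m (3 ^ k)) $$ (r, r')" .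
qed (simp_all add: reindexed_tensor_def)

text \<open>The coordinatewise permutation \<open>\<pi>\<close> covers both diagonals: the identity
  gives the main one and \<open>\<lambda>x. 2 - x\<close> the other. Permuting the columns of each
  array keeps its line sums.\<close>

lemma reindexed_tensor_square_sum:
  assumes L: "L \<in> carrier_mat k k"
    and supp: "\<And>s. s \<in> carrier_vec k - {0\<^sub>v k} \<Longrightarrow> supp (transpose_mat L *\<^sub>v s) \<noteq> supp s"
    and A: "\<And>i. i < k \<Longrightarrow> orthogonality_factor 3 (\<gamma> i) (A i)"
    and \<pi>: "bij \<pi>"
    and p: "\<And>v. v \<in> carrier_vec k \<Longrightarrow> p v \<in> carrier_vec k"
      "\<And>v i. v \<in> carrier_vec k \<Longrightarrow> i < k \<Longrightarrow> p v $ i = \<pi> (v $ i)"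
  shows "(\<Sum>v\<in>carrier_vec k. (reindexed_tensor k L A $$ (index_of_vec v, index_of_vec (p v)))\<^sup>2)
    = (\<Prod>i<k. \<gamma> i)"
proof -
  define f where "f i a b = complex_of_int ((A i $$ (digit a, digit (\<pi> b)))\<^sup>2)" for i a b
  have row: "(\<Sum>b\<in>UNIV. f i a b) = complex_of_int (\<gamma> i)" if "i < k" for i a
  proof -
    have "(\<Sum>b\<in>UNIV. f i a b) = (\<Sum>b\<in>UNIV. complex_of_int ((A i $$ (digit a, digit b))\<^sup>2))"
      unfolding f_def by (rule sum.reindex_bij_betw[OF \<pi>])
    also have "\<dots> = complex_of_int (\<Sum>j<3. A i $$ (digit a, j) * A i $$ (digit a, j))"
      by (subst sum_digit) (simp add: power2_eq_square)
    finally show ?thesis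
      using orthogonality_factor_row_product[OF A[OF that] digit_less digit_less, of a a]
      by (simp only: refl if_True)
  qed
  have column: "(\<Sum>a\<in>UNIV. f i a b) = complex_of_int (\<gamma> i)" if "i < k" for i b
  proof -
    have "(\<Sum>a\<in>UNIV. f i a b) = complex_of_int (\<Sum>j<3. (A i $$ (j, digit (\<pi> b)))\<^sup>2)"
      unfolding f_def by (subst sum_digit) simp
    then show ?thesis
      by (simp only: orthogonality_factor_column_square_sum[OF A[OF that] digit_less])
  qed
  \<comment> \<open>The Fourier argument lives in the complex numbers; injectivity of
    \<open>of_int\<close> brings the equation back to the integers.\<close>
  have "complex_of_int (\<Sum>v\<in>carrier_vec k.
        (reindexed_tensor k L A $$ (index_of_vec v, index_of_vec (p v)))\<^sup>2)
      = (\<Sum>v\<in>carrier_vec k. \<Prod>i<k. f i ((L *\<^sub>v v) $ i) (v $ i))"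
    unfolding of_int_sum using p
    by (intro sum.cong) (auto simp: reindexed_tensor_entry f_def simp flip: prod_power_distrib)
  also have "\<dots> = complex_of_int (\<Prod>i<k. \<gamma> i)"
    using sum_prod_constant_line_sums[OF L supp row column] by simp
  finally show ?thesis by (simp only: of_int_eq_iff)
qed

theorem theorem3p4:
  fixes k :: nat and L :: "3 mat" and A :: "nat \<Rightarrow> int mat" and \<gamma> :: "nat \<Rightarrow> int"
  assumes "k \<ge> 1"
    and "L \<in> carrier_mat k k" and "invertible_mat L"
    and "\<And>s. s \<in> carrier_vec k - {0\<^sub>v k} \<Longrightarrow> supp (transpose_mat L *\<^sub>v s) \<noteq> supp s"
    and "\<And>i. i < k \<Longrightarrow> orthogonality_factor 3 (\<gamma> i) (A i)"
  shows "(\<Sum>v\<in>carrier_vec k.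
      (reindexed_tensor k L A $$ (index_of_vec v, index_of_vec v))\<^sup>2) = (\<Prod>i<k. \<gamma> i)
    \<and> (\<Sum>v\<in>carrier_vec k.
      (reindexed_tensor k L A $$ (index_of_vec v, index_of_vec (vec_bar v)))\<^sup>2) = (\<Prod>i<k. \<gamma> i)
    \<and> euler_magic (3 ^ k) (\<Prod>i<k. \<gamma> i) (reindexed_tensor k L A)"
proof -
  let ?M = "reindexed_tensor k L A"
  have diagonal: "(\<Sum>v\<in>carrier_vec k. (?M $$ (index_of_vec v, index_of_vec v))\<^sup>2) = (\<Prod>i<k. \<gamma> i)"
    using reindexed_tensor_square_sum[where \<pi> = id and p = "\<lambda>v. v", OF assms(2,4,5)] by simp
  have "bij (\<lambda>x :: 3. 2 - x)"
    by (rule bij_betw_byWitness[where f' = "\<lambda>x. 2 - x"]) auto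
  then have antidiagonal:
    "(\<Sum>v\<in>carrier_vec k. (?M $$ (index_of_vec v, index_of_vec (vec_bar v)))\<^sup>2) = (\<Prod>i<k. \<gamma> i)"
    by (intro reindexed_tensor_square_sum[where \<pi> = "\<lambda>x. 2 - x"] assms) (auto simp: vec_bar_def)
  have "(\<Sum>i<3 ^ k. (?M $$ (i, i))\<^sup>2) = (\<Prod>i<k. \<gamma> i)"
    using diagonal by (simp only: sum_index_of_vec[of "\<lambda>i. (?M $$ (i, i))\<^sup>2"])
  moreover have "(\<Sum>i<3 ^ k. (?M $$ (i, 3 ^ k - 1 - i))\<^sup>2) = (\<Prod>i<k. \<gamma> i)"
    \<comment> \<open>Under the digit encoding, \<open>3 ^ k - 1 - i\<close> is the index of the
      \<open>vec_bar\<close> of the vector with index \<open>i\<close>.\<close>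
    unfolding sum_index_of_vec[of "\<lambda>i. (?M $$ (i, 3 ^ k - 1 - i))\<^sup>2", symmetric]
      antidiagonal[symmetric]
    by (intro sum.cong) (auto simp: index_of_vec_bar)
  moreover have "(\<Prod>i<k. \<gamma> i) \<noteq> 0"
    using assms(5) by (auto simp: orthogonality_factor_def)
  moreover have "?M \<in> carrier_mat (3 ^ k) (3 ^ k)"
    by (simp add: reindexed_tensor_def)
  ultimately have "euler_magic (3 ^ k) (\<Prod>i<k. \<gamma> i) ?M"
    using reindexed_tensor_orthogonal[OF assms(2,3,5)] by (simp add: euler_magic_def)
  with diagonal antidiagonal show ?thesis by blast
qed

end
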